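(* There exists a sequence $(x_k)_{k=1}^{\infty}$ in $[0,1]\cong\mathbb{S}^1$ and a universal constant $0<c<\infty$ such that for all $r\in\mathbb{N}$ and all $n\in\mathbb{N}$ sufficiently large (depending on $r$) the first $n$ elements of the sequence satisfy $$\frac{\text{largest length of } r \text{ consecutive intervals}}{\text{smallest length of } r \text{ consecutive intervals}}\leq 1+\frac{c\log r}{r}.$$
   Context: $\mathbb{S}^1\cong[0,1)$ is the unit circle, normalized to have length $1$ (the points $0$ and $1$ are identified). The sequence $(x_k)$ is interpreted as the places where the circular stick $\mathbb{S}^1$ is successively broken; with $x_0=0$ also counted as a breaking point, the first $n$ elements $x_1,\dots,x_n$ break it into $n+1$ intervals. The "length of $r$ consecutive intervals" means the total length of $r$ of these intervals that are adjacent to each other in cyclic order on the circle; the largest and the smallest are taken over all choices of $r$ consecutive intervals after the first $n$ steps.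
   Formalization: The bound is proved for all r ≥ 2; r = 1 is excluded because the bound would then be 1, forcing all intervals to be equal for every large n, which is impossible since one further break leaves another interval unchanged; r = 0 is excluded as the bound is undefined. *)

theory Defs
  imports Complex_Main
begin

text \<open>
  The circle is the interval from 0 to 1 with its endpoints identified; \<open>frac\<close> sends a point of
  the closed unit interval to its representative in \<open>{0..<1}\<close>, in particular 1 to 0.
  The breaking sequence is indexed from 1, and \<open>x 0 = 0\<close> is the initial breaking point.
  Injectivity says that every step hits a new point of the circle, so that the first \<open>n\<close> steps
  really produce \<open>n + 1\<close> intervals (all of positive length).
\<close>

definition breaking_sequence :: "(nat \<Rightarrow> real) \<Rightarrow> bool" where
  "breaking_sequence x \<longleftrightarrow>
     x 0 = 0 \<and> (\<forall>k\<ge>1. x k \<in> {0..1}) \<and> inj (\<lambda>k. frac (x k))"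

definition breaking_points :: "(nat \<Rightarrow> real) \<Rightarrow> nat \<Rightarrow> real list" where
  "breaking_points x n = sort (map (\<lambda>k. frac (x k)) [0..<Suc n])"

text \<open>
  The intervals after \<open>n\<close> steps are numbered \<open>0, \<dots>, n\<close> in cyclic order; the last one runs from
  the largest breaking point through 1 back to the smallest one.
\<close>

definition interval_length :: "(nat \<Rightarrow> real) \<Rightarrow> nat \<Rightarrow> nat \<Rightarrow> real" where
  "interval_length x n i =
     (if i < n then breaking_points x n ! Suc i else 1 + breaking_points x n ! 0)
       - breaking_points x n ! i"

text \<open>
  The \<open>r\<close> intervals are distinct exactly when \<open>r \<le> n + 1\<close>, which is the only case of interest.
\<close>

definition consecutive_length :: "(nat \<Rightarrow> real) \<Rightarrow> nat \<Rightarrow> nat \<Rightarrow> nat \<Rightarrow> real" where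
  "consecutive_length x n r i = (\<Sum>j<r. interval_length x n ((i + j) mod Suc n))"

definition largest_length :: "(nat \<Rightarrow> real) \<Rightarrow> nat \<Rightarrow> nat \<Rightarrow> real" where
  "largest_length x n r = Max (consecutive_length x n r ` {0..n})"

definition smallest_length :: "(nat \<Rightarrow> real) \<Rightarrow> nat \<Rightarrow> nat \<Rightarrow> real" where
  "smallest_length x n r = Min (consecutive_length x n r ` {0..n})"

end

theory Submission
  imports Defs
begin

text \<open>
  The binary van der Corput sequence works, with constant \<open>28 / ln 2\<close>.

  Its even terms are a half-size copy of the whole sequence in the left half of the circle, and its
  odd terms a half-size copy in the right half. Iterating this, each dyadic interval of length
  \<open>1 / 2 ^ j\<close> receives every \<open>2 ^ j\<close>-th term, so the number of the first \<open>m\<close> terms in it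
  differs from \<open>m / 2 ^ j\<close> by at most 1, for every \<open>m\<close> (\<open>count_dyadic_interval\<close>).

  Let \<open>2 ^ k \<le> m < 2 ^ (k + 1)\<close>. Then all breaking points are multiples of \<open>1 / 2 ^ (k + 1)\<close>, and
  all multiples of \<open>1 / 2 ^ k\<close> are breaking points, so every interval has length between
  \<open>1 / 2 ^ (k + 1)\<close> and \<open>1 / 2 ^ k\<close>. Hence \<open>r\<close> consecutive intervals form an arc of length at
  most \<open>r / 2 ^ k\<close>, with endpoints on the grid of mesh \<open>1 / 2 ^ (k + 1)\<close>. Such an arc splits into
  only \<open>O(log r)\<close> dyadic intervals, because their sizes run from the mesh up to about \<open>r\<close>
  times the mesh with at most two of each. The dyadic errors add up, and the arc \<open>L\<close> satisfies
  \<open>\<bar>m * L - r\<bar> = O(log r)\<close> (\<open>discrepancy_short_interval\<close>, \<open>consecutive_length_near_mean\<close>). The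
  essential gain over a discrepancy estimate for arbitrary arcs, which would give \<open>log m\<close>, is
  that short arcs see only few scales. Two such lengths differ by \<open>O(log r) / m\<close> while each is at
  least \<open>r / 2 ^ (k + 1) \<ge> r / (2 * m)\<close>, which gives the ratio \<open>1 + O(log r / r)\<close>.
\<close>

section \<open>The van der Corput sequence\<close>

text \<open>
  The binary digits of \<open>n\<close> are mirrored at the binary point. Peeling off the last digit of \<open>n\<close>,
  which becomes the leading one, exposes the self-similarity on which all later inductions rest.
\<close>

fun van_der_corput :: "nat \<Rightarrow> real" where
  "van_der_corput n =
     (if n = 0 then 0 else (van_der_corput (n div 2) + real (n mod 2)) / 2)"

declare van_der_corput.simps [simp del]

lemma van_der_corput_0 [simp]: "van_der_corput 0 = 0"
  by (simp add: van_der_corput.simps)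

lemma van_der_corput_even [simp]: "van_der_corput (2 * n) = van_der_corput n / 2"
  by (cases "n = 0") (simp_all add: van_der_corput.simps[of "2 * n"])

lemma van_der_corput_odd [simp]: "van_der_corput (Suc (2 * n)) = (van_der_corput n + 1) / 2"
  by (simp add: van_der_corput.simps[of "Suc (2 * n)"])

lemma van_der_corput_bounds: "0 \<le> van_der_corput n \<and> van_der_corput n < 1"
  by (induction n rule: nat_bit_induct) auto

lemmas van_der_corput_nonneg [simp] = van_der_corput_bounds[THEN conjunct1]
lemmas van_der_corput_less_1 [simp] = van_der_corput_bounds[THEN conjunct2]

text \<open>
  The leading binary digit of the value is the parity of the index, and the remaining digits
  belong to the halved index.
\<close>

lemma van_der_corput_eq_iff [simp]:
  "van_der_corput i = van_der_corput j \<longleftrightarrow> i = j"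
proof (induction "i + j" arbitrary: i j rule: less_induct)
  case less
  have bounds: "0 \<le> van_der_corput k" "van_der_corput k < 1" for k by simp_all
  show ?case
  proof (cases "even i = even j")
    case True
    define a b where "a = i div 2" and "b = j div 2"
    from True consider "i = 2 * a" "j = 2 * b" | "i = Suc (2 * a)" "j = Suc (2 * b)"
      unfolding a_def b_def by (metis dvd_mult_div_cancel odd_two_times_div_two_succ Suc_eq_plus1)
    then show ?thesis
      using less[of a b] by cases (cases "a + b = 0"; auto)+
  next
    case False
    then consider a b where "i = 2 * a" "j = Suc (2 * b)"
      | a b where "i = Suc (2 * a)" "j = 2 * b"
      by (metis evenE oddE Suc_eq_plus1)
    then show ?thesis
    proof cases
      case 1
      have "van_der_corput i < van_der_corput j" using bounds(2)[of a] bounds(1)[of b]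
        unfolding 1 by (simp del: van_der_corput_nonneg van_der_corput_less_1)
      then show ?thesis by auto
    next
      case 2
      have "van_der_corput j < van_der_corput i" using bounds(1)[of a] bounds(2)[of b]
        unfolding 2 by (simp del: van_der_corput_nonneg van_der_corput_less_1)
      then show ?thesis by auto
    qed
  qed
qed

lemma van_der_corput_dyadic:
  "i < 2 ^ K \<Longrightarrow> \<exists>t::nat. van_der_corput i = t / 2 ^ K"
proof (induction K arbitrary: i)
  case 0
  then show ?case by simp
next
  case (Suc K)
  have "i div 2 < 2 ^ K" using Suc.prems by (simp add: less_mult_imp_div_less mult.commute)
  then obtain t :: nat where t: "van_der_corput (i div 2) = t / 2 ^ K" using Suc.IH by blast
  show ?case
  proof (cases "even i")
    case True
    then have "van_der_corput i = t / 2 ^ Suc K"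
      using t van_der_corput_even[of "i div 2"] by simp
    then show ?thesis by blast
  next
    case False
    then have "van_der_corput i = (t + 2 ^ K :: nat) / 2 ^ Suc K"
      using t van_der_corput_odd[of "i div 2"] by (simp add: add_divide_distrib)
    then show ?thesis by blast
  qed
qed

lemma dyadic_van_der_corput:
  "q < 2 ^ k \<Longrightarrow> \<exists>i<2 ^ k. van_der_corput i = real q / 2 ^ k"
proof (induction k arbitrary: q)
  case 0
  then show ?case by simp
next
  case (Suc k)
  show ?case
  proof (cases "q < 2 ^ k")
    case True
    then obtain i where i: "i < 2 ^ k" "van_der_corput i = real q / 2 ^ k"
      using Suc.IH by blast
    then show ?thesis by (intro exI[of _ "2 * i"]) simp
  next
    case False
    then have "q - 2 ^ k < 2 ^ k" using Suc.prems by simp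
    then obtain i where i: "i < 2 ^ k" "van_der_corput i = real (q - 2 ^ k) / 2 ^ k"
      using Suc.IH by blast
    have "van_der_corput (Suc (2 * i)) = real q / 2 ^ Suc k"
      using False by (simp add: i(2) of_nat_diff diff_divide_distrib)
    then show ?thesis using i(1) by (intro exI[of _ "Suc (2 * i)"]) simp
  qed
qed

section \<open>Local discrepancy\<close>

text \<open>
  Counts are taken over initial segments \<open>{0..<y}\<close>; an arbitrary interval is a difference of two.
\<close>

definition count_below :: "nat \<Rightarrow> real \<Rightarrow> nat" where
  "count_below m y = card {i. i < m \<and> van_der_corput i < y}"

lemma count_below_0_left [simp]: "count_below 0 y = 0"
  by (simp add: count_below_def)

lemma count_below_Suc:
  "count_below (Suc m) y = count_below m y + (if van_der_corput m < y then 1 else 0)"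
proof -
  have "{i. i < Suc m \<and> van_der_corput i < y} =
    (if van_der_corput m < y then insert m {i. i < m \<and> van_der_corput i < y}
     else {i. i < m \<and> van_der_corput i < y})"
    by (auto simp: less_Suc_eq)
  then show ?thesis by (simp add: count_below_def)
qed

lemma count_below_0_right [simp]: "count_below m 0 = 0"
  by (simp add: count_below_def not_less)

lemma count_below_1 [simp]: "count_below m 1 = m"
  by (simp add: count_below_def)

text \<open>
  Only the terms of even index can lie below \<open>1 / 2\<close>, and doubling turns them into the first
  \<open>\<lceil>m / 2\<rceil>\<close> terms of the sequence itself.
\<close>

lemma count_below_left_half:
  assumes "y \<le> 1 / 2"
  shows "count_below m y = count_below ((m + 1) div 2) (2 * y)"
proof (induction m)
  case 0
  then show ?case by simp
next
  case (Suc m)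
  show ?case
  proof (cases "even m")
    case True
    then obtain k where "m = 2 * k" by blast
    then show ?thesis using Suc by (auto simp: count_below_Suc)
  next
    case False
    then obtain k where k: "m = Suc (2 * k)" by (metis oddE Suc_eq_plus1)
    have "\<not> van_der_corput m < y"
      using assms van_der_corput_nonneg[of k] by (simp add: k del: van_der_corput_nonneg)
    then show ?thesis using Suc k by (auto simp: count_below_Suc)
  qed
qed

text \<open>
  Beyond the middle all even terms are counted, and the odd ones are again a copy of the sequence.
\<close>

lemma count_below_right_half:
  assumes "1 / 2 \<le> y"
  shows "count_below m y = (m + 1) div 2 + count_below (m div 2) (2 * y - 1)"
proof (induction m)
  case 0
  then show ?case by simp
next
  case (Suc m)
  show ?case
  proof (cases "even m")
    case True
    then obtain k where k: "m = 2 * k" by blast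
    have "van_der_corput m < y"
      using assms van_der_corput_less_1[of k] by (simp add: k del: van_der_corput_less_1)
    then show ?thesis using Suc k by (auto simp: count_below_Suc)
  next
    case False
    then obtain k where "m = Suc (2 * k)" by (metis oddE Suc_eq_plus1)
    then show ?thesis using Suc by (auto simp: count_below_Suc)
  qed
qed

text \<open>
  Rescaling a half of the circle to the whole circle replaces \<open>m\<close> by one of the two roundings of
  \<open>m / 2\<close>. For an interval of length \<open>1 / 2 ^ (j + 1)\<close> this changes the expected count by at most
  \<open>1 / 2 ^ (j + 1)\<close>, and the bound is the sum of this geometric series.
\<close>

lemma count_dyadic_interval:
  "q < 2 ^ j \<Longrightarrow>
   \<bar>real (count_below m ((real q + 1) / 2 ^ j)) - real (count_below m (real q / 2 ^ j))
      - real m / 2 ^ j\<bar> \<le> 1 - 1 / 2 ^ j"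
proof (induction j arbitrary: q m)
  case 0
  then show ?case by simp
next
  case (Suc j)
  have near: "\<bar>real l / 2 ^ j - real m / 2 ^ Suc j\<bar> \<le> 1 / 2 ^ Suc j"
    if "\<bar>2 * real l - real m\<bar> \<le> 1" for l
  proof -
    have "real l / 2 ^ j - real m / 2 ^ Suc j = (2 * real l - real m) / 2 ^ Suc j"
      by (simp add: field_simps)
    then show ?thesis using that by (simp add: abs_divide divide_right_mono)
  qed
  have split: "(1::real) - 1 / 2 ^ Suc j = (1 - 1 / 2 ^ j) + 1 / 2 ^ Suc j"
    by (simp add: field_simps)
  show ?case
  proof (cases "q < 2 ^ j")
    case True
    define l where "l = (m + 1) div 2"
    have "real (Suc q) \<le> 2 ^ j"
      using True by (metis Suc_leI of_nat_le_iff of_nat_numeral of_nat_power)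
    then have le: "(real q + 1) / 2 ^ Suc j \<le> 1 / 2" "real q / 2 ^ Suc j \<le> 1 / 2"
      using True by (simp_all add: divide_simps)
    have eq: "2 * ((real q + 1) / 2 ^ Suc j) = (real q + 1) / 2 ^ j"
      "2 * (real q / 2 ^ Suc j) = real q / 2 ^ j"
      by (simp_all add: field_simps)
    have "\<bar>2 * real l - real m\<bar> \<le> 1" unfolding l_def by linarith
    from near[OF this] Suc.IH[OF True, of l] show ?thesis
      unfolding split count_below_left_half[OF le(1), of m] count_below_left_half[OF le(2), of m] eq
        l_def[symmetric] by linarith
  next
    case False
    define l p where "l = m div 2" and "p = q - 2 ^ j"
    have p: "p < 2 ^ j" "real q = real p + 2 ^ j"
      using False Suc.prems by (simp_all add: p_def of_nat_diff)
    have ge: "1 / 2 \<le> (real q + 1) / 2 ^ Suc j" "1 / 2 \<le> real q / 2 ^ Suc j"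
      by (simp_all add: p field_simps)
    have eq: "2 * ((real q + 1) / 2 ^ Suc j) - 1 = (real p + 1) / 2 ^ j"
      "2 * (real q / 2 ^ Suc j) - 1 = real p / 2 ^ j"
      by (simp_all add: p field_simps)
    have "\<bar>2 * real l - real m\<bar> \<le> 1" unfolding l_def by linarith
    from near[OF this] Suc.IH[OF p(1), of l] show ?thesis
      unfolding split count_below_right_half[OF ge(1), of m] count_below_right_half[OF ge(2), of m] eq
      by (simp add: l_def[symmetric])
  qed
qed

text \<open>
  Taking \<open>frac\<close> makes this a function on the circle: the defects at 0 and at 1 both vanish, so
  arcs through the base point need no separate treatment.
\<close>

definition discrepancy :: "nat \<Rightarrow> real \<Rightarrow> real" where
  "discrepancy m y = real (count_below m (frac y)) - real m * frac y"

lemma discrepancy_dyadic_interval: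
  "\<bar>discrepancy m (real (Suc q) / 2 ^ j) - discrepancy m (real q / 2 ^ j)\<bar> \<le> 1"
proof -
  define p where "p = q mod 2 ^ j"
  have p: "p < 2 ^ j" by (simp add: p_def)
  then have p': "real (Suc p) \<le> 2 ^ j"
    by (metis Suc_leI of_nat_le_iff of_nat_numeral of_nat_power)
  have q: "real q = real p + 2 ^ j * real (q div 2 ^ j)"
    by (metis p_def mod_mult_div_eq of_nat_add of_nat_mult of_nat_numeral of_nat_power)
  have shift: "(a + 2 ^ j * real (q div 2 ^ j)) / 2 ^ j = a / 2 ^ j + of_int (int (q div 2 ^ j))"
    for a :: real by (simp add: field_simps)
  have periodic: "discrepancy m (y + of_int z) = discrepancy m y" for y z
    by (simp add: discrepancy_def frac_def)
  have unit: "discrepancy m y = real (count_below m y) - real m * y" if "0 \<le> y" "y \<le> 1" for y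
  proof (cases "y = 1")
    case True
    then show ?thesis by (simp add: discrepancy_def)
  next
    case False
    then have "frac y = y" using that by (simp add: frac_eq)
    then show ?thesis by (simp add: discrepancy_def)
  qed
  have left: "discrepancy m (real q / 2 ^ j) =
      real (count_below m (real p / 2 ^ j)) - real m * (real p / 2 ^ j)"
    unfolding q shift periodic using p by (intro unit) (auto simp: divide_simps)
  have "real (Suc q) = (real p + 1) + 2 ^ j * real (q div 2 ^ j)" using q by simp
  then have right: "discrepancy m (real (Suc q) / 2 ^ j) =
      real (count_below m ((real p + 1) / 2 ^ j)) - real m * ((real p + 1) / 2 ^ j)"
    using p' by (simp only: shift periodic, intro unit) (auto simp: divide_simps)
  have "real m * ((real p + 1) / 2 ^ j) = real m * (real p / 2 ^ j) + real m / 2 ^ j"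
    by (simp add: add_divide_distrib distrib_left)
  moreover have "0 \<le> 1 / (2::real) ^ j" by simp
  ultimately show ?thesis
    using count_dyadic_interval[OF p, of m] unfolding left right by linarith
qed

text \<open>
  Clearing the lowest \<open>d\<close> binary digits of a grid point one at a time crosses, for each nonzero
  digit, exactly one dyadic interval.
\<close>

lemma discrepancy_round_down:
  "d \<le> K \<Longrightarrow>
   \<bar>discrepancy m (real t / 2 ^ K) - discrepancy m (real (t div 2 ^ d) / 2 ^ (K - d))\<bar> \<le> real d"
proof (induction d)
  case 0
  then show ?case by simp
next
  case (Suc d)
  define q where "q = t div 2 ^ d"
  have q': "t div 2 ^ Suc d = q div 2"
    by (simp add: q_def div_mult2_eq[symmetric] mult.commute)
  have K: "K - d = Suc (K - Suc d)" using Suc.prems by simp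
  have IH: "\<bar>discrepancy m (real t / 2 ^ K) - discrepancy m (real q / 2 ^ (K - d))\<bar> \<le> real d"
    using Suc by (simp add: q_def)
  have same: "real (q div 2) / 2 ^ (K - Suc d) = real (2 * (q div 2)) / 2 ^ (K - d)"
    by (simp add: K)
  have "\<bar>discrepancy m (real q / 2 ^ (K - d)) -
         discrepancy m (real (2 * (q div 2)) / 2 ^ (K - d))\<bar> \<le> 1"
  proof (cases "even q")
    case True
    then show ?thesis by simp
  next
    case False
    then have "q = Suc (2 * (q div 2))" by presburger
    then show ?thesis using discrepancy_dyadic_interval[of m "2 * (q div 2)" "K - d"] by metis
  qed
  then show ?case using IH unfolding q' same of_nat_Suc by linarith
qed

text \<open>
  Two grid points at most \<open>2 ^ d\<close> steps apart round down to the same or to neighbouring multiples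
  of \<open>2 ^ d\<close>. The bound depends on \<open>d\<close> alone and not on the fineness \<open>K\<close> of the grid, which is what
  makes the final estimate uniform in the number of points.
\<close>

lemma discrepancy_short_interval:
  assumes "t \<le> t'" "t' \<le> t + 2 ^ d" "d \<le> K"
  shows "\<bar>discrepancy m (real t' / 2 ^ K) - discrepancy m (real t / 2 ^ K)\<bar> \<le> 2 * real d + 1"
proof -
  define a b where "a = t div 2 ^ d" and "b = t' div 2 ^ d"
  have "b \<le> (t + 2 ^ d) div 2 ^ d" unfolding b_def using assms(2) by (rule div_le_mono)
  then have "b \<le> Suc a" by (simp add: a_def)
  moreover have "a \<le> b" unfolding a_def b_def using assms(1) by (rule div_le_mono)
  ultimately consider "b = a" | "b = Suc a" by linarith
  then have "\<bar>discrepancy m (real b / 2 ^ (K - d)) - discrepancy m (real a / 2 ^ (K - d))\<bar> \<le> 1"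
    by cases (use discrepancy_dyadic_interval[of m a "K - d"] in simp_all)
  then show ?thesis
    using discrepancy_round_down[OF assms(3), of m t] discrepancy_round_down[OF assms(3), of m t']
    unfolding a_def b_def by linarith
qed

section \<open>The periodic extension of the breaking points\<close>

text \<open>
  The breaking points are lifted from the circle to the half-line, each full turn adding 1. On the
  half-line the lengths of consecutive intervals telescope, with no case distinction at the
  base point.
\<close>

definition unrolled_point :: "(nat \<Rightarrow> real) \<Rightarrow> nat \<Rightarrow> nat \<Rightarrow> real" where
  "unrolled_point x n t = breaking_points x n ! (t mod Suc n) + real (t div Suc n)"

lemma interval_length_unrolled:
  "interval_length x n (t mod Suc n) = unrolled_point x n (Suc t) - unrolled_point x n t"
proof (cases "Suc (t mod Suc n) = Suc n")
  case True
  then show ?thesis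
    by (simp add: interval_length_def unrolled_point_def mod_Suc div_Suc)
next
  case False
  moreover have "t mod Suc n < Suc n" by simp
  ultimately have "t mod Suc n < n" by linarith
  then show ?thesis
    by (simp add: interval_length_def unrolled_point_def mod_Suc div_Suc)
qed

lemma consecutive_length_unrolled:
  "consecutive_length x n r i = unrolled_point x n (i + r) - unrolled_point x n i"
  by (induction r) (simp_all add: consecutive_length_def interval_length_unrolled)

lemma frac_van_der_corput [simp]: "frac (van_der_corput k) = van_der_corput k"
  by (simp add: frac_eq)

lemma breaking_sequence_van_der_corput: "breaking_sequence van_der_corput"
  by (auto simp: breaking_sequence_def inj_def less_imp_le)

section \<open>Breaking at the van der Corput points\<close>

text \<open>
  The number of points \<open>n + 1\<close> (that is, \<open>0\<close> and the first \<open>n\<close> breaks) lies between two consecutive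
  powers of 2; \<open>k\<close> names the finest dyadic level all of whose grid points are already broken.
\<close>

locale van_der_corput_points =
  fixes n k :: nat
  assumes size: "2 ^ k \<le> Suc n" "Suc n < 2 ^ Suc k"
begin

abbreviation "points \<equiv> breaking_points van_der_corput n"
abbreviation "point \<equiv> unrolled_point van_der_corput n"

lemma length_points [simp]: "length points = Suc n"
  by (simp add: breaking_points_def)

lemma set_points: "set points = van_der_corput ` {..<Suc n}"
  by (auto simp: breaking_points_def)

lemma sorted_points: "sorted_wrt (<) points"
proof -
  have "distinct points" by (auto simp: breaking_points_def distinct_map inj_on_def)
  moreover have "sorted points" by (simp add: breaking_points_def)
  ultimately show ?thesis by (simp add: strict_sorted_iff)
qed

lemma points_less_iff: "i \<le> n \<Longrightarrow> j \<le> n \<Longrightarrow> points ! i < points ! j \<longleftrightarrow> i < j"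
  using sorted_points
  by (metis length_points less_Suc_eq_le linorder_neqE_nat order_less_asym sorted_wrt_nth_less)

lemma count_below_point:
  assumes "i \<le> n"
  shows "count_below (Suc n) (points ! i) = i"
proof -
  have "count_below (Suc n) (points ! i) = card (van_der_corput ` {j. j < Suc n \<and> van_der_corput j < points ! i})"
    unfolding count_below_def by (rule card_image[symmetric]) (simp add: inj_on_def)
  also have "van_der_corput ` {j. j < Suc n \<and> van_der_corput j < points ! i} =
      {y \<in> set points. y < points ! i}"
    by (auto simp: set_points)
  also have "\<dots> = (!) points ` {..<i}"
  proof (intro set_eqI iffI)
    fix y assume "y \<in> {y \<in> set points. y < points ! i}"
    then obtain j where "j \<le> n" "y = points ! j" "points ! j < points ! i"
      by (auto simp: in_set_conv_nth less_Suc_eq_le)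
    then show "y \<in> (!) points ` {..<i}" using assms by (simp add: points_less_iff)
  next
    fix y assume "y \<in> (!) points ` {..<i}"
    then obtain j where "j < i" "y = points ! j" by blast
    then show "y \<in> {y \<in> set points. y < points ! i}"
      using assms by (simp add: points_less_iff)
  qed
  also have "card \<dots> = i"
    using sorted_points assms
    by (subst card_image) (auto simp: inj_on_def nth_eq_iff_index_eq strict_sorted_iff)
  finally show ?thesis .
qed

lemma points_unit: "i \<le> n \<Longrightarrow> 0 \<le> points ! i \<and> points ! i < 1"
  using set_points nth_mem[of i points] by auto

text \<open>
  Exactly \<open>t mod (n + 1)\<close> breaking points precede the \<open>t\<close>-th one, and each full turn contributes
  \<open>n + 1\<close> to both terms on the right. So differences of discrepancies compare the number of
  consecutive intervals with their rescaled length.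
\<close>

lemma discrepancy_point:
  "discrepancy (Suc n) (point t) = real t - real (Suc n) * point t"
proof -
  define i where "i = t mod Suc n"
  have i: "i \<le> n" by (simp add: i_def less_Suc_eq_le[symmetric])
  \<comment> \<open>The whole turns are cast through the integers, over which \<open>frac\<close> is periodic.\<close>
  have "frac (point t) = frac (points ! i + of_int (int (t div Suc n)))"
    by (simp add: unrolled_point_def i_def)
  also have "\<dots> = points ! i"
    using points_unit[OF i] by (simp add: frac_unique_iff)
  finally have "discrepancy (Suc n) (point t) = real i - real (Suc n) * (points ! i)"
    by (simp only: discrepancy_def count_below_point[OF i])
  moreover have "real t = real i + real (Suc n) * real (t div Suc n)"
    unfolding i_def by (metis mod_mult_div_eq of_nat_add of_nat_mult)
  ultimately show ?thesis
    unfolding unrolled_point_def i_def[symmetric] by (simp only: distrib_left)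
qed

lemma point_dyadic: "\<exists>a::nat. point t = a / 2 ^ Suc k"
proof -
  have "points ! (t mod Suc n) \<in> set points" by (rule nth_mem) simp
  then obtain j where j: "j < Suc n" "points ! (t mod Suc n) = van_der_corput j"
    by (auto simp: set_points)
  with size obtain a :: nat where "points ! (t mod Suc n) = a / 2 ^ Suc k"
    using van_der_corput_dyadic[of j "Suc k"] by fastforce
  then have "point t = real (a + 2 ^ Suc k * (t div Suc n)) / 2 ^ Suc k"
    by (simp add: unrolled_point_def field_simps)
  then show ?thesis by blast
qed

lemma interval_length_pos:
  assumes "i \<le> n"
  shows "0 < interval_length van_der_corput n i"
  using assms points_unit[of i] points_unit[of 0] points_less_iff[of i "Suc i"]
  by (auto simp: interval_length_def)

text \<open>
  The next multiple of \<open>1 / 2 ^ k\<close> after a breaking point is itself a breaking point (or the end 1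
  of the turn), so the following break comes no later.
\<close>

lemma interval_length_le:
  assumes "i \<le> n"
  shows "interval_length van_der_corput n i \<le> 1 / 2 ^ k"
proof -
  define y q where "y = points ! i" and "q = nat \<lfloor>2 ^ k * y\<rfloor>"
  have y: "0 \<le> y" "y < 1" using points_unit[OF assms] by (simp_all add: y_def)
  then have q: "real q \<le> 2 ^ k * y" "2 ^ k * y < real (Suc q)"
    by (simp_all add: q_def) linarith+
  have "real q < 2 ^ k"
    using q(1) y by (smt (verit) mult_less_cancel_left2 zero_less_power)
  then have "q < 2 ^ k" by (metis of_nat_less_iff of_nat_numeral of_nat_power)
  have lt: "y < real (Suc q) / 2 ^ k" using q(2) by (simp add: field_simps)
  have le: "real (Suc q) / 2 ^ k \<le> y + 1 / 2 ^ k" using q(1) by (simp add: field_simps)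
  show ?thesis
  proof (cases "Suc q < 2 ^ k")
    case True
    then obtain j where "j < 2 ^ k" "van_der_corput j = real (Suc q) / 2 ^ k"
      using dyadic_van_der_corput by blast
    then have "real (Suc q) / 2 ^ k \<in> set points" using size(1) unfolding set_points
      by (metis imageI lessThan_iff order_less_le_trans)
    then obtain l where l: "l \<le> n" "points ! l = real (Suc q) / 2 ^ k"
      by (auto simp: in_set_conv_nth less_Suc_eq_le)
    with lt assms have "i < l" using points_less_iff[of i l] by (simp add: y_def)
    then have "points ! Suc i \<le> points ! l"
      using l(1) points_less_iff[of l "Suc i"] by fastforce
    then show ?thesis using \<open>i < l\<close> l le by (simp add: interval_length_def y_def)
  next
    case False
    with \<open>q < 2 ^ k\<close> have "Suc q = 2 ^ k" by linarith
    then have "real (Suc q) = 2 ^ k" by (metis of_nat_numeral of_nat_power)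
    with le have one: "1 - y \<le> 1 / 2 ^ k" by simp
    have "0 \<in> set points" using van_der_corput_0 by (force simp: set_points)
    then obtain l where "l \<le> n" "points ! l = 0"
      by (auto simp: in_set_conv_nth less_Suc_eq_le)
    then have "points ! 0 = 0"
      using points_less_iff[of l 0] points_unit[of 0] by auto
    then show ?thesis
      using one points_unit[of "Suc i"] assms by (auto simp: interval_length_def y_def)
  qed
qed

text \<open>
  Neighbouring breaking points are distinct points of the grid of mesh \<open>1 / 2 ^ (k + 1)\<close>.
\<close>

lemma interval_length_ge:
  assumes "i \<le> n"
  shows "1 / 2 ^ Suc k \<le> interval_length van_der_corput n i"
proof -
  obtain a b :: nat where ab: "point i = a / 2 ^ Suc k" "point (Suc i) = b / 2 ^ Suc k"
    using point_dyadic by meson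
  have eq: "interval_length van_der_corput n i = (real b - real a) / 2 ^ Suc k"
    using interval_length_unrolled[of van_der_corput n i] assms ab
    by (simp add: diff_divide_distrib)
  with interval_length_pos[OF assms] have "a < b" by (simp add: zero_less_divide_iff)
  then have "1 \<le> real b - real a" by linarith
  then show ?thesis unfolding eq by (intro divide_right_mono) simp_all
qed

lemma consecutive_length_ge: "real r / 2 ^ Suc k \<le> consecutive_length van_der_corput n r i"
  unfolding consecutive_length_def
  using sum_bounded_below[of "{..<r}" "1 / 2 ^ Suc k"
      "\<lambda>j. interval_length van_der_corput n ((i + j) mod Suc n)"] interval_length_ge
  by (simp add: less_Suc_eq_le[symmetric])

lemma consecutive_length_le: "consecutive_length van_der_corput n r i \<le> real r / 2 ^ k"
  unfolding consecutive_length_def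
  using sum_bounded_above[of "{..<r}" "\<lambda>j. interval_length van_der_corput n ((i + j) mod Suc n)"
      "1 / 2 ^ k"] interval_length_le
  by (simp add: less_Suc_eq_le[symmetric])

text \<open>
  By \<open>consecutive_length_le\<close>, \<open>r\<close> consecutive intervals cover at most \<open>2 * r\<close> steps of the grid of
  mesh \<open>1 / 2 ^ (k + 1)\<close>, so \<open>d\<close> only has to grow like the logarithm of \<open>r\<close>.
\<close>

lemma consecutive_length_near_mean:
  assumes "2 * r \<le> 2 ^ d" "d \<le> Suc k"
  shows "\<bar>real (Suc n) * consecutive_length van_der_corput n r i - real r\<bar> \<le> 2 * real d + 1"
proof -
  obtain a b :: nat where ab: "point i = a / 2 ^ Suc k" "point (i + r) = b / 2 ^ Suc k"
    using point_dyadic by meson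
  have len: "consecutive_length van_der_corput n r i = (real b - real a) / 2 ^ Suc k"
    by (simp add: consecutive_length_unrolled ab diff_divide_distrib)
  have "0 \<le> consecutive_length van_der_corput n r i"
    by (rule order_trans[OF _ consecutive_length_ge]) simp
  then have "0 \<le> real b - real a" unfolding len by (simp add: pos_le_divide_eq)
  then have "a \<le> b" by linarith
  moreover have "real b - real a \<le> 2 * real r"
    using consecutive_length_le[of r i] unfolding len by (simp add: divide_le_eq)
  then have "b \<le> a + 2 ^ d" using assms(1) by linarith
  ultimately have "\<bar>discrepancy (Suc n) (point (i + r)) - discrepancy (Suc n) (point i)\<bar>
      \<le> 2 * real d + 1"
    unfolding ab using assms(2) by (rule discrepancy_short_interval)
  then show ?thesis
    unfolding discrepancy_point consecutive_length_unrolled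
    by (simp add: algebra_simps abs_minus_commute)
qed

text \<open>
  The number 28 arises as \<open>2 * 7 * 2\<close>: two lengths are compared, each deviates from the mean by
  \<open>2 * d + 1 \<le> 2 * log 2 r + 5 \<le> 7 * log 2 r\<close> after multiplication by \<open>n + 1\<close>, and the shorter one
  is then still at least \<open>r / 2\<close>. The last bound comes from the mesh rather than from the mean, so
  it is available for small \<open>r\<close> as well, where the deviation may exceed \<open>r\<close>.
\<close>

lemma consecutive_length_ratio:
  assumes "2 \<le> r" "4 * r \<le> n"
  shows "consecutive_length van_der_corput n r i / consecutive_length van_der_corput n r j
      \<le> 1 + 28 * log 2 (real r) / real r"
proof -
  define L where "L = consecutive_length van_der_corput n r"
  \<comment> \<open>The least \<open>d\<close> with \<open>2 * r \<le> 2 ^ d\<close>; then \<open>2 ^ d \<le> 4 * r\<close>, and \<open>n \<ge> 4 * r\<close> makes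
     a dyadic interval of \<open>2 ^ d\<close> grid steps fit into the circle.\<close>
  define d where "d = nat \<lceil>log 2 (real r)\<rceil> + 1"
  have lg: "1 \<le> log 2 (real r)" using assms(1) by (simp add: le_log_iff)
  then have d: "log 2 (real r) \<le> real (d - 1)" "real d < log 2 (real r) + 2"
    unfolding d_def by linarith+
  have r: "real r = 2 powr log 2 (real r)" using assms(1) by simp
  also have "\<dots> \<le> 2 powr real (d - 1)" using d(1) by (intro powr_mono) simp_all
  finally have "real r \<le> 2 ^ (d - 1)" by (simp add: powr_realpow)
  then have "real (2 * r) \<le> real (2 ^ d)" by (simp add: d_def)
  then have d1: "2 * r \<le> 2 ^ d" by (simp only: of_nat_le_iff)
  have "real (2 ^ d) = 2 powr real d" by (simp add: powr_realpow)
  also have "\<dots> \<le> 2 powr (log 2 (real r) + 2)" using d(2) by (intro powr_mono) simp_all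
  also have "\<dots> = real (4 * r)" using assms(1) by (simp add: powr_add)
  finally have "2 ^ d \<le> 4 * r" by (simp only: of_nat_le_iff)
  also have "\<dots> < 2 ^ Suc k" using assms(2) size(2) by linarith
  finally have d2: "d \<le> Suc k" by (meson less_imp_le power_less_imp_less_exp one_less_numeral_iff semiring_norm(76))
  have near: "\<bar>real (Suc n) * L l - real r\<bar> \<le> 7 * log 2 (real r)" for l
    using consecutive_length_near_mean[OF d1 d2, of l] d(2) lg unfolding L_def by linarith
  have diff: "real (Suc n) * (L i - L j) \<le> 14 * log 2 (real r)"
    using near[of i] near[of j] unfolding right_diff_distrib by linarith
  have "real (2 ^ k) \<le> real (Suc n)" using size(1) by (simp only: of_nat_le_iff)
  then have "real r / 2 = 2 ^ k * (real r / 2 ^ Suc k)" by (simp add: field_simps)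
  also have "\<dots> \<le> real (Suc n) * L j"
    using \<open>real (2 ^ k) \<le> real (Suc n)\<close> consecutive_length_ge[of r j]
    unfolding L_def by (intro mult_mono) simp_all
  finally have ge: "real r / 2 \<le> real (Suc n) * L j" .
  have pos: "0 < real (Suc n) * L j" using ge assms(1) by linarith
  then have Lj: "L j > 0" by (simp add: zero_less_mult_iff)
  then have "L i / L j = 1 + (real (Suc n) * (L i - L j)) / (real (Suc n) * L j)"
    by (simp add: diff_divide_distrib)
  also have "\<dots> \<le> 1 + (14 * log 2 (real r)) / (real (Suc n) * L j)"
    using diff pos by (intro add_left_mono divide_right_mono) simp_all
  also have "\<dots> \<le> 1 + (14 * log 2 (real r)) / (real r / 2)"
    using ge pos lg assms(1) by (intro add_left_mono divide_left_mono) simp_all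
  finally show ?thesis by (simp add: L_def)
qed

end

theorem theorem2:
  "\<exists>(x :: nat \<Rightarrow> real) (c :: real). breaking_sequence x \<and> 0 < c \<and>
     (\<forall>r::nat. r \<ge> 2 \<longrightarrow>
       (\<exists>N::nat. \<forall>n\<ge>N.
          largest_length x n r / smallest_length x n r \<le> 1 + c * ln (real r) / real r))"
proof (intro exI conjI allI impI)
  show "breaking_sequence van_der_corput" by (rule breaking_sequence_van_der_corput)
  show "0 < 28 / ln (2::real)" by simp
  fix r n :: nat
  assume r: "2 \<le> r" and n: "4 * r \<le> n"
  obtain k where "2 ^ k \<le> Suc n" "Suc n < 2 ^ Suc k"
    using ex_power_ivl1[of 2 "Suc n"] by auto
  then interpret van_der_corput_points n k by unfold_locales
  let ?L = "consecutive_length van_der_corput n r"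
  have "Max (?L ` {0..n}) \<in> ?L ` {0..n}" "Min (?L ` {0..n}) \<in> ?L ` {0..n}"
    by (rule Max_in Min_in; simp)+
  then obtain i j where "Max (?L ` {0..n}) = ?L i" "Min (?L ` {0..n}) = ?L j" by blast
  then show "largest_length van_der_corput n r / smallest_length van_der_corput n r
      \<le> 1 + 28 / ln 2 * ln (real r) / real r"
    using consecutive_length_ratio[OF r n, of i j]
    by (simp add: largest_length_def smallest_length_def log_def)
qed

end
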